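(* For any $T>0$, almost surely $Y(t)>0$ for (Lebesgue) almost every $t\in[0,T]$; hence almost surely $Y(t)>0$ for almost every $t\in\mathbb R_+$.
   Context: $B^H=\{B^H(t),t\ge0\}$ is a fractional Brownian motion with Hurst index $H\in(0,1/2)$ on a probability space $(\Omega,\mathcal F,\mathbb P)$, i.e. a centered Gaussian process with covariance $\mathbb E[B^H(t)B^H(s)]=\frac12(t^{2H}+s^{2H}-|t-s|^{2H})$ and continuous paths starting at $0$. $Y_0,k,a,\sigma>0$ are constants. For $\varepsilon>0$, $Y_\varepsilon=\{Y_\varepsilon(t),t\ge0\}$ is the unique (pathwise, continuous) solution of $$Y_\varepsilon(t)=Y_0+\int_0^t\frac{k}{Y_\varepsilon(s)\mathbf 1_{\{Y_\varepsilon(s)>0\}}+\varepsilon}\,ds-a\int_0^tY_\varepsilon(s)\,ds+\sigma B^H(t),\quad t\ge0.$$ $Y_\varepsilon(t)$ increases as $\varepsilon$ decreases, and $Y(t)=\lim_{\varepsilon\downarrow0}Y_\varepsilon(t)$, $t\ge0$, is the pointwise limit. Only finite and locally Lebesgue integrable paths of $Y$ are considered (this excludes only a null set). *)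

theory Defs
  imports "HOL-Probability.Probability"
begin

text \<open>Degenerate (constant) laws count as Gaussian; this is needed for finite-dimensional laws
  with singular covariance, e.g. those of processes starting at a deterministic point.\<close>

definition gaussian_rv :: "'w measure \<Rightarrow> ('w \<Rightarrow> real) \<Rightarrow> bool" where
  "gaussian_rv M X \<longleftrightarrow>
     X \<in> borel_measurable M \<and>
     (\<exists>m. (AE \<omega> in M. X \<omega> = m) \<or>
          (\<exists>s>0. distributed M lborel X (\<lambda>x. ennreal (normal_density m s x))))"

text \<open>Joint normality of all finite-dimensional marginals, expressed as usual through
  linear combinations.\<close>

definition gaussian_process :: "'w measure \<Rightarrow> 'i set \<Rightarrow> ('i \<Rightarrow> 'w \<Rightarrow> real) \<Rightarrow> bool" where
  "gaussian_process M I X \<longleftrightarrow>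
     (\<forall>J c. finite J \<and> J \<subseteq> I \<longrightarrow> gaussian_rv M (\<lambda>\<omega>. \<Sum>i\<in>J. c i * X i \<omega>))"

text \<open>Time is \<^typ>\<open>real\<close>; only the values at nonnegative times are constrained.\<close>

locale fractional_brownian_motion = prob_space M
  for M :: "'w measure" and H :: real and B :: "real \<Rightarrow> 'w \<Rightarrow> real" +
  assumes hurst_index: "0 < H" "H < 1"
    and gaussian: "gaussian_process M {0..} B"
    and centered: "\<And>t. 0 \<le> t \<Longrightarrow> expectation (B t) = 0"
    and covariance: "\<And>s t. 0 \<le> s \<Longrightarrow> 0 \<le> t \<Longrightarrow>
          expectation (\<lambda>\<omega>. B t \<omega> * B s \<omega>)
            = (t powr (2 * H) + s powr (2 * H) - \<bar>t - s\<bar> powr (2 * H)) / 2"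
    and starts_at_0: "\<And>\<omega>. \<omega> \<in> space M \<Longrightarrow> B 0 \<omega> = 0"
    and continuous_paths: "\<And>\<omega>. \<omega> \<in> space M \<Longrightarrow> continuous_on {0..} (\<lambda>t. B t \<omega>)"

text \<open>The equation is pathwise: \<open>b\<close> is a path of the driving noise and \<open>y\<close> the solution path.
  For continuous \<open>y\<close> both integrands are continuous, since \<open>z * indicat_real {0<..} z = max z 0\<close>,
  so the integrals are genuine.\<close>

definition approx_solution ::
  "real \<Rightarrow> real \<Rightarrow> real \<Rightarrow> real \<Rightarrow> real \<Rightarrow> (real \<Rightarrow> real) \<Rightarrow> (real \<Rightarrow> real) \<Rightarrow> bool" where
  "approx_solution Y\<^sub>0 k a \<sigma> \<epsilon> b y \<longleftrightarrow>
     continuous_on {0..} y \<and>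
     (\<forall>t\<ge>0. y t = Y\<^sub>0 + (LBINT s:{0..t}. k / (y s * indicat_real {0<..} (y s) + \<epsilon>))
                     - a * (LBINT s:{0..t}. y s) + \<sigma> * b t)"

end

theory Submission imports Defs
begin

text \<open>The argument is pathwise. After its last visit to the level \<open>Y\<^sub>0\<close> an approximate solution has
  drift at most \<open>k / Y\<^sub>0\<close>, so on \<open>[0, T]\<close> it is bounded above uniformly in \<open>\<epsilon>\<close>. The equation at time
  \<open>T\<close> then bounds the integral of \<open>k / (max Y\<^sub>\<epsilon> 0 + \<epsilon>)\<close> over \<open>[0, T]\<close> uniformly in \<open>\<epsilon>\<close>. Where the limit
  is \<open>\<le> 0\<close> this integrand tends to infinity, so by Fatou's lemma that happens only on a null set.\<close>

lemma times_indicat_pos_eq_max: "z * indicat_real {0<..} z = max 0 z"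
  by (auto simp: indicator_def max_def)

lemma LBINT_atLeastAtMost_eq_integral:
  fixes f :: "real \<Rightarrow> real"
  assumes "continuous_on {a..b} f"
  shows "(LBINT s:{a..b}. f s) = integral {a..b} f"
  using borel_integrable_atLeastAtMost'[OF assms] by (rule set_borel_integral_eq_integral(2))

lemma continuous_on_singular_drift:
  fixes y :: "real \<Rightarrow> real"
  assumes "continuous_on S y" "\<epsilon> > 0"
  shows "continuous_on S (\<lambda>s. k / (max 0 (y s) + \<epsilon>))"
  using assms(2) by (intro continuous_intros assms(1)) (auto simp: max_def add_nonneg_eq_0_iff)

lemma approx_solution_continuous_on:
  assumes "approx_solution Y\<^sub>0 k a \<sigma> \<epsilon> b y"
  shows "continuous_on {0..t} y"
  using assms unfolding approx_solution_def by (auto intro: continuous_on_subset)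

text \<open>Both integrands are continuous on \<open>{0..t}\<close>, so the Lebesgue integrals in
  the equation agree with gauge integrals, whose rules for splitting and comparison are used from
  here on.\<close>

lemma approx_solution_integral_eq:
  assumes sol: "approx_solution Y\<^sub>0 k a \<sigma> \<epsilon> b y" and eps: "\<epsilon> > 0" and t: "t \<ge> 0"
  shows "y t = Y\<^sub>0 + integral {0..t} (\<lambda>s. k / (max 0 (y s) + \<epsilon>))
           - a * integral {0..t} y + \<sigma> * b t"
proof -
  have y: "continuous_on {0..t} y" by (rule approx_solution_continuous_on[OF sol])
  show ?thesis
    using sol t LBINT_atLeastAtMost_eq_integral[OF y]
      LBINT_atLeastAtMost_eq_integral[OF continuous_on_singular_drift[OF y eps]]
    unfolding approx_solution_def times_indicat_pos_eq_max by simp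
qed

text \<open>Subtracting the equations at the two times lets the dynamics restart at
  \<open>s\<close>; below, \<open>s\<close> is the last visit to the level
  \<open>Y\<^sub>0\<close>.\<close>

lemma approx_solution_increment:
  assumes sol: "approx_solution Y\<^sub>0 k a \<sigma> \<epsilon> b y" and eps: "\<epsilon> > 0" and st: "0 \<le> s" "s \<le> t"
  shows "y t - y s = integral {s..t} (\<lambda>u. k / (max 0 (y u) + \<epsilon>) - a * y u) + \<sigma> * (b t - b s)"
proof -
  let ?d = "\<lambda>u. k / (max 0 (y u) + \<epsilon>)"
  have y: "continuous_on {0..t} y" by (rule approx_solution_continuous_on[OF sol])
  have d: "continuous_on {0..t} ?d"
    by (rule continuous_on_singular_drift[OF y eps])
  have split: "integral {0..s} f + integral {s..t} f = integral {0..t} f" "f integrable_on {s..t}"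
    if "continuous_on {0..t} f" for f :: "real \<Rightarrow> real"
    using that st
    by (auto intro!: Henstock_Kurzweil_Integration.integral_combine integrable_continuous_real
        intro: continuous_on_subset)
  have "integral {s..t} (\<lambda>u. ?d u - a * y u) = integral {s..t} ?d - a * integral {s..t} y"
    using Henstock_Kurzweil_Integration.integral_diff[OF split(2)[OF d]
        split(2)[OF continuous_on_mult_left[OF y, of a]]]
    by simp
  moreover have "a * integral {0..t} y = a * integral {0..s} y + a * integral {s..t} y"
    unfolding split(1)[OF y, symmetric] by (rule distrib_left)
  ultimately show ?thesis
    using approx_solution_integral_eq[OF sol eps, of t] approx_solution_integral_eq[OF sol eps, of s]
      split(1)[OF d] st
    by (simp add: algebra_simps)
qed

text \<open>The term \<open>k / Y\<^sub>0 * T\<close> pays for the drift after the last visit to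
  \<open>Y\<^sub>0\<close>, and \<open>2 * \<sigma> * K\<close> for the noise increment. Neither
  depends on \<open>\<epsilon>\<close>.\<close>

lemma approx_solution_upper_bound:
  assumes sol: "approx_solution Y\<^sub>0 k a \<sigma> \<epsilon> b y" and eps: "\<epsilon> > 0"
    and pos: "Y\<^sub>0 > 0" "k > 0" "a > 0" "\<sigma> > 0"
    and b0: "b 0 = 0" and K: "\<And>s. s \<in> {0..T} \<Longrightarrow> \<bar>b s\<bar> \<le> K"
    and t: "t \<in> {0..T}"
  shows "y t \<le> Y\<^sub>0 + k / Y\<^sub>0 * T + 2 * \<sigma> * K"
proof (cases "y t \<le> Y\<^sub>0")
  case True
  have "K \<ge> 0" using K[OF t] by simp
  then have "0 \<le> k / Y\<^sub>0 * T" "0 \<le> 2 * \<sigma> * K" using pos t by auto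
  with True show ?thesis by linarith
next
  case False
  have y: "continuous_on {0..t} y" by (rule approx_solution_continuous_on[OF sol])
  have y0: "y 0 = Y\<^sub>0"
    using approx_solution_integral_eq[OF sol eps, of 0] b0 by simp
  \<comment> \<open>The visits to the starting level form a compact set containing 0, so there is a
    last one before \<open>t\<close>.\<close>
  let ?S = "{s \<in> {0..t}. y s = Y\<^sub>0}"
  have "closed ?S" by (rule continuous_closed_preimage_constant[OF y]) simp
  moreover have "bounded ?S" by (rule bounded_subset[OF bounded_closed_interval]) blast
  ultimately have "compact ?S" by (simp add: compact_eq_bounded_closed)
  moreover have "?S \<noteq> {}" using y0 t by auto
  ultimately obtain \<tau> where \<tau>: "\<tau> \<in> ?S" and last: "\<And>s. s \<in> ?S \<Longrightarrow> s \<le> \<tau>"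
    using compact_attains_sup[of ?S] by blast
  \<comment> \<open>Since \<open>y t\<close> exceeds \<open>Y\<^sub>0\<close>, a value below the
    level at \<open>s\<close> would force another visit in \<open>{s..t}\<close>. It cannot come
    after \<open>\<tau>\<close>, so it would be at \<open>s\<close> itself.\<close>
  have ge: "Y\<^sub>0 \<le> y s" if s: "s \<in> {\<tau>..t}" for s
  proof (rule ccontr)
    assume less: "\<not> Y\<^sub>0 \<le> y s"
    have "continuous_on {s..t} y" using s \<tau> by (intro continuous_on_subset[OF y]) auto
    then have "\<exists>x\<ge>s. x \<le> t \<and> y x = Y\<^sub>0"
      using less False s by (intro IVT') auto
    then obtain x where x: "s \<le> x" "x \<le> t" "y x = Y\<^sub>0" by blast
    then have "x \<le> \<tau>" using s \<tau> by (intro last) auto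
    then have "x = s" using x(1) s by simp
    with x(3) less show False by simp
  qed
  have y': "continuous_on {\<tau>..t} y" using \<tau> by (intro continuous_on_subset[OF y]) auto
  have "integral {\<tau>..t} (\<lambda>u. k / (max 0 (y u) + \<epsilon>) - a * y u) \<le> integral {\<tau>..t} (\<lambda>u. k / Y\<^sub>0)"
  proof (rule integral_le)
    show "(\<lambda>u. k / (max 0 (y u) + \<epsilon>) - a * y u) integrable_on {\<tau>..t}"
      by (intro integrable_continuous_real continuous_intros continuous_on_singular_drift y' eps)
    fix u assume u: "u \<in> {\<tau>..t}"
    \<comment> \<open>The denominator is at least \<open>y u\<close>, hence at least
      \<open>Y\<^sub>0\<close>.\<close>
    have "k / (max 0 (y u) + \<epsilon>) \<le> k / Y\<^sub>0"
      using ge[OF u] pos eps by (intro divide_left_mono) auto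
    moreover have "0 \<le> a * y u" using ge[OF u] pos by simp
    ultimately show "k / (max 0 (y u) + \<epsilon>) - a * y u \<le> k / Y\<^sub>0" by linarith
  qed auto
  also have "\<dots> = k / Y\<^sub>0 * (t - \<tau>)" using \<tau> by simp
  also have "\<dots> \<le> k / Y\<^sub>0 * T" using \<tau> t pos by (intro mult_left_mono) auto
  finally have "y t - y \<tau> \<le> k / Y\<^sub>0 * T + \<sigma> * (b t - b \<tau>)"
    using approx_solution_increment[OF sol eps, of \<tau> t] \<tau> by simp
  moreover have "\<sigma> * (b t - b \<tau>) \<le> \<sigma> * (2 * K)"
    using K[OF t] K[of \<tau>] \<tau> t pos by (intro mult_left_mono) auto
  ultimately show ?thesis using \<tau> by simp
qed

text \<open>Solve the equation at time \<open>T\<close> for the singular integral. Every other term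
  needs only a one-sided estimate: \<open>y\<close> is at most \<open>C\<close> throughout,
  \<open>- b T\<close> is at most \<open>K\<close>, and \<open>- Y\<^sub>0\<close> is negative and
  is dropped.\<close>

lemma approx_solution_singular_integral_bound:
  assumes sol: "approx_solution Y\<^sub>0 k a \<sigma> \<epsilon> b y" and eps: "\<epsilon> > 0"
    and pos: "Y\<^sub>0 > 0" "k > 0" "a > 0" "\<sigma> > 0"
    and b0: "b 0 = 0" and K: "\<And>s. s \<in> {0..T} \<Longrightarrow> \<bar>b s\<bar> \<le> K"
    and T: "T > 0" and C: "C = Y\<^sub>0 + k / Y\<^sub>0 * T + 2 * \<sigma> * K"
  shows "integral {0..T} (\<lambda>s. k / (max 0 (y s) + \<epsilon>)) \<le> C + a * C * T + \<sigma> * K"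
proof -
  have y: "continuous_on {0..T} y" by (rule approx_solution_continuous_on[OF sol])
  have le: "y t \<le> C" if "t \<in> {0..T}" for t
    unfolding C using approx_solution_upper_bound[OF sol eps pos b0 K that] .
  have "integral {0..T} y \<le> integral {0..T} (\<lambda>s. C)"
    using le by (intro integral_le integrable_continuous_real y) auto
  then have "a * integral {0..T} y \<le> a * (C * T)"
    using pos T by (intro mult_left_mono) (auto simp: mult.commute)
  moreover have "- (\<sigma> * b T) \<le> \<sigma> * K"
    using K[of T] T pos mult_left_mono[of "- b T" K \<sigma>] by auto
  ultimately show ?thesis
    using approx_solution_integral_eq[OF sol eps, of T] le[of T] pos(1) T
    unfolding mult.assoc atLeastAtMost_iff by linarith
qed

text \<open>This is the Fatou argument for one fixed noise path. The limit is extended real, so an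
  infinite value counts as positive.\<close>

lemma AE_limit_of_approx_solutions_pos:
  fixes Y :: "real \<Rightarrow> ereal"
  assumes sol: "\<And>\<epsilon>. \<epsilon> > 0 \<Longrightarrow> approx_solution Y\<^sub>0 k a \<sigma> \<epsilon> b (y \<epsilon>)"
    and pos: "Y\<^sub>0 > 0" "k > 0" "a > 0" "\<sigma> > 0"
    and b: "continuous_on {0..} b" "b 0 = 0"
    and lim: "\<And>t. t \<ge> 0 \<Longrightarrow> ((\<lambda>\<epsilon>. ereal (y \<epsilon> t)) \<longlongrightarrow> Y t) (at_right 0)"
    and T: "T > 0"
  shows "AE t in lborel. t \<in> {0..T} \<longrightarrow> Y t > 0"
proof -
  \<comment> \<open>Fatou's lemma concerns sequences, so the limit at 0 from the right is sampled
    along 1/(n+1), which is positive from n = 0 on.\<close>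
  define e where "e n = inverse (real (Suc n))" for n
  define d where "d n s = k / (max 0 (y (e n) s) + e n)" for n s
  \<comment> \<open>Values in \<open>ennreal\<close> allow the pointwise liminf to be infinite,
    which is the event to be excluded.\<close>
  define f where "f n s = ennreal (indicator {0..T} s *\<^sub>R d n s)" for n s
  have e: "e n > 0" for n by (simp add: e_def)
  have e_lim: "e \<longlonglongrightarrow> 0" unfolding e_def by (rule LIMSEQ_inverse_real_of_nat)
  have e_right: "filterlim e (at_right 0) sequentially"
    unfolding filterlim_at using e_lim e by (simp add: less_imp_neq[THEN not_sym])
  have "compact (b ` {0..T})"
    by (intro compact_continuous_image continuous_on_subset[OF b(1)]) auto
  then have "bounded (b ` {0..T})" by (rule compact_imp_bounded)
  then obtain K where K: "\<And>s. s \<in> {0..T} \<Longrightarrow> \<bar>b s\<bar> \<le> K"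
    unfolding bounded_iff ball_simps real_norm_def by blast
  \<comment> \<open>The bound on the singular integral over \<open>{0..T}\<close>, common to all
    \<open>n\<close>.\<close>
  define D where "D = (let C = Y\<^sub>0 + k / Y\<^sub>0 * T + 2 * \<sigma> * K in C + a * C * T + \<sigma> * K)"
  have d_cont: "continuous_on {0..T} (d n)" for n
    unfolding d_def
    by (rule continuous_on_singular_drift[OF approx_solution_continuous_on[OF sol[OF e]] e])
  have d_nonneg: "d n s \<ge> 0" for n s
    unfolding d_def using pos e[of n] by simp
  have f_meas: "f n \<in> borel_measurable lborel" for n
    unfolding f_def using borel_measurable_continuous_on_indicator[OF _ d_cont] by simp
  have f_bound: "(\<integral>\<^sup>+s. f n s \<partial>lborel) \<le> ennreal D" for n
  proof -
    have "(\<integral>\<^sup>+s. f n s \<partial>lborel) = ennreal (LBINT s:{0..T}. d n s)"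
      unfolding f_def set_lebesgue_integral_def
      using borel_integrable_atLeastAtMost'[OF d_cont] d_nonneg
      by (intro nn_integral_eq_integral) (auto simp: set_integrable_def)
    also have "(LBINT s:{0..T}. d n s) \<le> D"
      unfolding LBINT_atLeastAtMost_eq_integral[OF d_cont] D_def Let_def
      unfolding d_def
      by (rule approx_solution_singular_integral_bound[OF sol[OF e] e pos b(2) K T refl])
    finally show ?thesis by (simp add: ennreal_leI)
  qed
  have "(\<integral>\<^sup>+s. liminf (\<lambda>n. f n s) \<partial>lborel) \<le> liminf (\<lambda>n. \<integral>\<^sup>+s. f n s \<partial>lborel)"
    by (rule nn_integral_liminf[OF f_meas])
  also have "\<dots> \<le> ennreal D"
    by (rule order_trans[OF Liminf_mono[where g = "\<lambda>_. ennreal D"]])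
      (auto simp: f_bound Liminf_const)
  finally have "(\<integral>\<^sup>+s. liminf (\<lambda>n. f n s) \<partial>lborel) \<noteq> \<infinity>"
    by (auto simp: top_unique)
  then have "AE s in lborel. liminf (\<lambda>n. f n s) \<noteq> \<infinity>"
    using f_meas by (intro nn_integral_noteq_infinite) auto
  then show ?thesis
  proof (rule AE_mp, intro AE_I2 impI)
    fix s assume fin: "liminf (\<lambda>n. f n s) \<noteq> \<infinity>" and s: "s \<in> {0..T}"
    show "Y s > 0"
    proof (rule ccontr)
      assume "\<not> Y s > 0"
      then have Ys: "Y s \<le> 0" by simp
      have y_lim: "(\<lambda>n. ereal (y (e n) s)) \<longlonglongrightarrow> Y s"
        using filterlim_compose[OF lim e_right] s by simp
      \<comment> \<open>The truncation supplies the lower bound 0, so an upper estimate suffices;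
        this also covers a negative or infinitely negative \<open>Y s\<close>.\<close>
      have "(\<lambda>n. max 0 (y (e n) s)) \<longlonglongrightarrow> 0"
      proof (rule order_tendstoI)
        fix r :: real assume "r > 0"
        then have "Y s < ereal r" using Ys by (simp add: order.strict_trans1)
        then have "\<forall>\<^sub>F n in sequentially. ereal (y (e n) s) < ereal r"
          by (rule order_tendstoD(2)[OF y_lim])
        then show "\<forall>\<^sub>F n in sequentially. max 0 (y (e n) s) < r"
          using \<open>r > 0\<close> by (auto elim: eventually_mono)
      qed (auto intro: always_eventually less_le_trans)
      then have "(\<lambda>n. max 0 (y (e n) s) + e n) \<longlonglongrightarrow> 0"
        using tendsto_add[OF _ e_lim] by fastforce
      \<comment> \<open>The summand \<open>e n\<close> keeps the denominators strictly positive, so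
        their reciprocals tend to plus infinity.\<close>
      then have "LIM n sequentially. inverse (max 0 (y (e n) s) + e n) :> at_top"
        using e by (intro filterlim_inverse_at_top) (auto intro!: always_eventually add_nonneg_pos)
      then have "LIM n sequentially. d n s :> at_top"
        unfolding d_def divide_inverse
        by (rule filterlim_tendsto_pos_mult_at_top[OF tendsto_const \<open>k > 0\<close>])
      then have "(\<lambda>n. f n s) \<longlonglongrightarrow> \<infinity>"
        using s by (simp add: f_def ennreal_tendsto_top_eq_at_top)
      then have "liminf (\<lambda>n. f n s) = \<infinity>"
        by (intro lim_imp_Liminf) auto
      with fin show False by simp
    qed
  qed
qed

theorem corollary3p1:
  fixes M :: "'w measure" and H Y\<^sub>0 k a \<sigma> :: real
    and B :: "real \<Rightarrow> 'w \<Rightarrow> real"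
    and Y\<^sub>\<epsilon> :: "real \<Rightarrow> real \<Rightarrow> 'w \<Rightarrow> real"
    and Y :: "real \<Rightarrow> 'w \<Rightarrow> ereal"
  assumes fbm: "fractional_brownian_motion M H B"
    and H: "0 < H" "H < 1 / 2"
    and pos: "Y\<^sub>0 > 0" "k > 0" "a > 0" "\<sigma> > 0"
    and sol: "\<And>\<epsilon> \<omega>. \<epsilon> > 0 \<Longrightarrow> \<omega> \<in> space M \<Longrightarrow>
                approx_solution Y\<^sub>0 k a \<sigma> \<epsilon> (\<lambda>t. B t \<omega>) (\<lambda>t. Y\<^sub>\<epsilon> \<epsilon> t \<omega>)"
    and lim: "\<And>t \<omega>. t \<ge> 0 \<Longrightarrow> \<omega> \<in> space M \<Longrightarrow>
                ((\<lambda>\<epsilon>. ereal (Y\<^sub>\<epsilon> \<epsilon> t \<omega>)) \<longlongrightarrow> Y t \<omega>) (at_right 0)"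
  shows "(\<forall>T>0. AE \<omega> in M. AE t in lborel. t \<in> {0..T} \<longrightarrow> Y t \<omega> > 0) \<and>
         (AE \<omega> in M. AE t in lborel. t \<ge> 0 \<longrightarrow> Y t \<omega> > 0)"
proof -
  interpret fractional_brownian_motion M H B by (rule fbm)
  \<comment> \<open>The statement holds on every path in \<open>space M\<close>, so no exceptional
    event arises in \<omega>.\<close>
  have path: "AE t in lborel. t \<in> {0..T} \<longrightarrow> Y t \<omega> > 0" if "\<omega> \<in> space M" "T > 0" for \<omega> T
    using that
    by (intro AE_limit_of_approx_solutions_pos[OF sol pos continuous_paths starts_at_0 lim])
  have "AE t in lborel. t \<ge> 0 \<longrightarrow> Y t \<omega> > 0" if \<omega>: "\<omega> \<in> space M" for \<omega>
  proof -
    \<comment> \<open>Countably many horizons exhaust the half-line, and a countable union of null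
      sets is null. Using \<open>Suc n\<close> keeps each horizon positive, as \<open>path\<close>
      requires.\<close>
    have "AE t in lborel. \<forall>n. t \<in> {0..real (Suc n)} \<longrightarrow> Y t \<omega> > 0"
      unfolding AE_all_countable using path[OF \<omega>] by simp
    then show ?thesis
    proof (rule AE_mp, intro AE_I2 impI)
      fix t :: real assume all: "\<forall>n. t \<in> {0..real (Suc n)} \<longrightarrow> Y t \<omega> > 0" and "t \<ge> 0"
      obtain n where "t \<le> real n" using real_arch_simple by blast
      then have "t \<in> {0..real (Suc n)}" using \<open>t \<ge> 0\<close> by simp
      with all show "Y t \<omega> > 0" by blast
    qed
  qed
  with path show ?thesis by (auto intro: AE_I2)
qed

end
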